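(* Let $F:\mathbb{R}^n\to\mathbb{R}^n$ be the tropical map of a face-generic polynomial map $f:\mathbb{K}^n\to\mathbb{K}^n$, and let $\Xi$ denote the polyhedral cell-decomposition of $\mathbb{R}^n$ induced by $F$. Then there exists a subset $\Upsilon\subset\Xi$ satisfying \[ \mathcal{TJ}(F)=\bigcup_{\xi\in\Upsilon}\mathcal{V}_\xi(F), \] where each $\overline{\mathcal{V}_\xi(F)}$ (Euclidean closure, $\xi\in\Upsilon$) is a polyhedron (an intersection of finitely many closed half-spaces). Here $\mathcal{TJ}(F)$ is the tropical non-properness set of $F$, and $\mathcal{V}_\xi(F)$ is the set of all $y\in\mathbb{R}^n$ whose virtual preimage $\mathcal{T}_y(F)$ intersects $\xi$.
   Context: **Base field.** $\Bbbk$ is an algebraically closed field of characteristic zero, and $\mathbb{K}$ is the algebraically closed field of (locally convergent) generalized Puiseux series, i.e. formal series $c(t)=\sum_{r\in R}c_rt^r$ with $c_r\in\Bbbk$ and $R\subset\mathbb{R}$ well-ordered and bounded from below; $\operatorname{val}(0)=-\infty$ and $\operatorname{val}(c)=-\min\{r: c_r\neq0\}$ for $c\neq 0$. $[n]=\{1,\ldots,n\}$. **Maps with given support.** $A=(A_1,\ldots,A_n)$ is a tuple of finite subsets of $\mathbb{N}^n\setminus\{\underline{0}\}$, $\underline{0}=(0,\ldots,0)$, such that the Minkowski sum $A_1+\cdots+A_n$ affinely spans $\mathbb{R}^n$. $\mathbb{K}^A$ is the space of tuples $f=(f_1,\ldots,f_n)$, $f_i=\sum_{a\in A_i}c_{i,a}z^a$,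 viewed as maps $\mathbb{K}^n\to\mathbb{K}^n$. The tropical map of $f\in\mathbb{K}^A$ is $F=(F_1,\ldots,F_n)$, $F_i(x)=\max_{a\in A_i,\,c_{i,a}\ne0}(\langle x,a\rangle+\operatorname{val}(c_{i,a}))$. **Tuple-faces.** $\Delta=(\Delta_1,\ldots,\Delta_n)$ with $\Delta_i=\operatorname{conv}(\{\underline{0}\}\cup A_i)$; $\sum\Delta$ is the Minkowski sum $\Delta_1+\cdots+\Delta_n$. A tuple $\Gamma=(\Gamma_1,\ldots,\Gamma_n)$ is a face of $\Delta$, written $\Gamma\prec\Delta$, if each $\Gamma_i$ is a face of $\Delta_i$ and $\sum\Gamma=\Gamma_1+\cdots+\Gamma_n$ is a face of $\sum\Delta$. $f_{i\Gamma}=\sum_{a\in\Gamma_i\cap A_i}c_{i,a}z^a$, $f_\Gamma=(f_{i\Gamma})_{i\in[n]}$, and for $I\subset[n]$, $f_{I\Gamma}=(f_{i\Gamma})_{i\in I}$ and $\sum I\Gamma=\sum_{i\in I}\Gamma_i$. For a tuple $g$ of polynomials, $V^*(g)\subset(\mathbb{K}^* )^n$ is the common zero set of its members in the torus. **Almost face-generic.** $f$ is almost face-generic if for any $\Gamma\prec\Delta$: (a) for any $\Gamma'\prec\Delta$ different from $\Gamma$, the sets $V^*(f_\Gamma)$ and $V^*(f_{\Gamma'})$ are equal only if both are empty; (b) for any $I\subset[n]$, the set $V^*(f_{I\Gamma})$ is a smooth irreducible complete intersection, and $\#I>\dim\sum I\Gamma$ implies $V^*(f_{I\Gamma})=\emptyset$.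 **Face-generic.** $f$ is face-generic if it is almost face-generic and, for any $\Gamma\prec\Delta$ and any $I\subset[n]$, the intersection over $i\in I$ of the tropical hypersurfaces of the $f_{i\Gamma}$ is transversal. Transversal means that all cells of the cell-decomposition of $\mathbb{R}^n$ induced by these tropical hypersurfaces are transversal: for every $x\in\mathbb{R}^n$, letting $\delta_i(x)$ be the convex hull of those $a\in\Gamma_i\cap A_i$ with $c_{i,a}\neq 0$ at which $\max(\langle x,a\rangle+\operatorname{val}(c_{i,a}))$ (over such $a$) is attained, one has $\dim\sum_{i\in I}\delta_i(x)=\sum_{i\in I}\dim\delta_i(x)$. **Cell-decomposition.** For $x\in\mathbb{R}^n$ let $\mathcal{I}_i(x)$ be the set of $a\in A_i$ with $c_{i,a}\neq0$ and $F_i(x)=\langle x,a\rangle+\operatorname{val}(c_{i,a})$. $\Xi$ is the finite partition of $\mathbb{R}^n$ into the classes of the relation "$\mathcal{I}_i(x)=\mathcal{I}_i(x')$ for all $i\in[n]$"; each class (cell) is the relative interior of a polyhedron. **Virtual preimage and tropical non-properness.** For $y\in\mathbb{R}^n$, $\mathcal{T}_{y_i}(F_i)$ is the set of points of $\mathbb{R}^n$ at which $x\mapsto\max(F_i(x),y_i)$ is not differentiable, and $\mathcal{T}_y(F)=\bigcap_{i=1}^n\mathcal{T}_{y_i}(F_i)$. A half-line that is a translate of $\alpha\cdot\mathbb{R}_{\ge0}$, $\alpha\in\mathbb{R}^n$, is dicritical if $\alpha_i>0$ and $\alpha_j\le0$ for some $i,j\in[n]$. $\mathcal{TJ}(F)$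 is the set of $y\in\mathbb{R}^n$ such that $\mathcal{T}_y(F)$ contains a dicritical half-line. *)

theory Defs
  imports "HOL-Analysis.Analysis" "HOL-Library.Poly_Mapping"
begin

section \<open>The field of generalized Puiseux series\<close>

text \<open>Facts on well-ordered sets of reals, used to construct the field operations.\<close>

lemma well_ordered_no_descent:
  fixes S :: "real set"
  assumes "wfp_on S (<)"
  shows "\<not> (\<exists>s::nat \<Rightarrow> real. (\<forall>n. s n \<in> S) \<and> (\<forall>n. s (Suc n) < s n))"
proof
  assume "\<exists>s::nat \<Rightarrow> real. (\<forall>n. s n \<in> S) \<and> (\<forall>n. s (Suc n) < s n)"
  then obtain s :: "nat \<Rightarrow> real" where s: "\<And>n. s n \<in> S" "\<And>n. s (Suc n) < s n" by blast
  have "range s \<subseteq> S" "range s \<noteq> {}" using s by auto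
  then obtain z where "z \<in> range s" "\<forall>y. y < z \<longrightarrow> y \<notin> range s"
    using assms unfolding wfp_on_iff_ex_minimal by meson
  then show False using s(2) by blast
qed

lemma well_orderedI_no_descent:
  fixes S :: "real set"
  assumes "\<And>s::nat \<Rightarrow> real. (\<And>n. s n \<in> S) \<Longrightarrow> (\<And>n. s (Suc n) < s n) \<Longrightarrow> False"
  shows "wfp_on S (<)"
  unfolding wfp_on_iff_ex_minimal
proof (intro allI impI, rule ccontr)
  fix B assume B: "B \<subseteq> S" "B \<noteq> {}" and no: "\<not> (\<exists>z\<in>B. \<forall>y. y < z \<longrightarrow> y \<notin> B)"
  have "\<exists>s. \<forall>n. s n \<in> B \<and> s (Suc n) < s n"
    by (rule dependent_nat_choice) (use B no in auto)
  then obtain s where "\<And>n. s n \<in> B \<and> s (Suc n) < s n" by blast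
  then show False using assms[of s] B(1) by blast
qed

lemma well_ordered_add:
  fixes P Q :: "real set"
  assumes P: "wfp_on P (<)" and Q: "wfp_on Q (<)"
  shows "wfp_on {p + q |p q. p \<in> P \<and> q \<in> Q} (<)"
proof (rule well_orderedI_no_descent)
  fix s :: "nat \<Rightarrow> real"
  assume s: "\<And>n. s n \<in> {p + q |p q. p \<in> P \<and> q \<in> Q}" and desc: "\<And>n. s (Suc n) < s n"
  from s obtain p q where pq: "\<And>n. s n = p n + q n" "\<And>n. p n \<in> P" "\<And>n. q n \<in> Q"
    unfolding mem_Collect_eq by metis
  obtain f :: "nat \<Rightarrow> nat" where f: "strict_mono f" "monoseq (\<lambda>n. p (f n))"
    using seq_monosub[of p] by blast
  have sdec: "s (f (Suc n)) < s (f n)" for n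
  proof -
    have "- s (f n) < - s (f (Suc n))"
      by (rule lift_Suc_mono_less[of "\<lambda>n. - s n"]) (use desc f(1) in \<open>auto simp: strict_mono_def\<close>)
    then show ?thesis by simp
  qed
  have "\<exists>N. \<forall>n\<ge>N. p (f n) \<le> p (f (Suc n))"
  proof (cases "incseq (\<lambda>n. p (f n))")
    case True
    then show ?thesis by (auto simp: incseq_Suc_iff)
  next
    case False
    then have dec: "decseq (\<lambda>n. p (f n))" using f(2) by (simp add: monoseq_iff)
    have "range (\<lambda>n. p (f n)) \<subseteq> P" "range (\<lambda>n. p (f n)) \<noteq> {}" using pq by auto
    then obtain z where z: "z \<in> range (\<lambda>n. p (f n))" "\<forall>y. y < z \<longrightarrow> y \<notin> range (\<lambda>n. p (f n))"
      using P unfolding wfp_on_iff_ex_minimal by meson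
    then obtain N where N: "z = p (f N)" by auto
    have "p (f n) \<le> p (f (Suc n))" if "n \<ge> N" for n
    proof -
      have "p (f n) \<le> p (f N)" using dec that by (auto simp: decseq_def)
      moreover have "p (f N) \<le> p (f (Suc n))" using z(2) N by (metis not_le rangeI)
      ultimately show ?thesis by linarith
    qed
    then show ?thesis by blast
  qed
  then obtain N where N: "\<And>n. n \<ge> N \<Longrightarrow> p (f n) \<le> p (f (Suc n))" by blast
  define t where "t n = q (f (N + n))" for n
  have "t (Suc n) < t n" for n
    using N[of "N + n"] sdec[of "N + n"] pq(1) by (simp add: t_def)
  moreover have "t n \<in> Q" for n using pq by (simp add: t_def)
  ultimately show False using well_ordered_no_descent[OF Q] by blast
qed

lemma well_ordered_finite:
  fixes P Q :: "real set"
  assumes P: "wfp_on P (<)" and Q: "wfp_on Q (<)"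
  shows "finite {p. p \<in> P \<and> r - p \<in> Q}"
proof (rule ccontr)
  assume inf: "infinite {p. p \<in> P \<and> r - p \<in> Q}" (is "infinite ?T")
  have ex: "\<exists>z\<in>B. \<forall>y\<in>B. z \<le> y" if "B \<subseteq> ?T" "B \<noteq> {}" for B
  proof -
    have "B \<subseteq> P" using that by auto
    then show ?thesis using P that(2) unfolding wfp_on_iff_ex_minimal
      by (meson not_le)
  qed
  have "\<exists>s. \<forall>n. (infinite {y\<in>?T. s n < y} \<and> s n \<in> ?T) \<and> s n < s (Suc n)"
  proof (rule dependent_nat_choice)
    obtain z where z: "z \<in> ?T" "\<forall>y\<in>?T. z \<le> y" using ex[of ?T] inf by (cases "?T = {}") auto
    have "?T \<subseteq> insert z {y\<in>?T. z < y}" using z by force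
    then have "infinite {y\<in>?T. z < y}" using inf by (meson finite_insert finite_subset)
    then show "\<exists>x. infinite {y\<in>?T. x < y} \<and> x \<in> ?T" using z by blast
  next
    fix x and n :: nat assume x: "infinite {y\<in>?T. x < y} \<and> x \<in> ?T"
    let ?B = "{y\<in>?T. x < y}"
    have "?B \<subseteq> ?T" "?B \<noteq> {}" using x by (blast, metis finite.emptyI)
    from ex[OF this] obtain z where z: "z \<in> ?B" "\<forall>y\<in>?B. z \<le> y" by blast
    have "?B \<subseteq> insert z {y\<in>?T. z < y}" using z by force
    then have "infinite {y\<in>?T. z < y}" using x by (meson finite_insert finite_subset)
    then show "\<exists>y. (infinite {ya\<in>?T. y < ya} \<and> y \<in> ?T) \<and> x < y" using z by blast
  qed
  then obtain s where s: "\<And>n. s n \<in> ?T" "\<And>n. s n < s (Suc n)" by blast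
  have "(\<forall>n. r - s n \<in> Q) \<and> (\<forall>n. r - s (Suc n) < r - s n)" using s by auto
  then show False using well_ordered_no_descent[OF Q] by (blast intro: exI[of _ "\<lambda>n. r - s n"])
qed

lemma well_ordered_Un:
  fixes P Q :: "real set"
  assumes "wfp_on P (<)" "wfp_on Q (<)"
  shows "wfp_on (P \<union> Q) (<)"
  unfolding wfp_on_iff_ex_minimal
proof (intro allI impI)
  fix B assume B: "B \<subseteq> P \<union> Q" "B \<noteq> {}"
  have P: "\<exists>z\<in>B \<inter> P. \<forall>y. y < z \<longrightarrow> y \<notin> B \<inter> P" if "B \<inter> P \<noteq> {}"
    using assms(1) that unfolding wfp_on_iff_ex_minimal by (meson inf_le2)
  have Q: "\<exists>z\<in>B \<inter> Q. \<forall>y. y < z \<longrightarrow> y \<notin> B \<inter> Q" if "B \<inter> Q \<noteq> {}"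
    using assms(2) that unfolding wfp_on_iff_ex_minimal by (meson inf_le2)
  consider "B \<inter> P = {}" | "B \<inter> Q = {}" | "B \<inter> P \<noteq> {}" "B \<inter> Q \<noteq> {}" by blast
  then show "\<exists>z\<in>B. \<forall>y. y < z \<longrightarrow> y \<notin> B"
  proof cases
    case 1
    with B have "B \<inter> Q \<noteq> {}" by blast
    from Q[OF this] 1 B(1) show ?thesis by blast
  next
    case 2
    with B have "B \<inter> P \<noteq> {}" by blast
    from P[OF this] 2 B(1) show ?thesis by blast
  next
    case 3
    obtain z w where z: "z \<in> B" "\<forall>y. y < z \<longrightarrow> y \<notin> B \<inter> P" and w: "w \<in> B" "\<forall>y. y < w \<longrightarrow> y \<notin> B \<inter> Q"
      using P[OF 3(1)] Q[OF 3(2)] by blast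
    have "min z w \<in> B" "\<forall>y. y < min z w \<longrightarrow> y \<notin> B"
      using z w B(1) by (auto simp: min_def)
    then show ?thesis by blast
  qed
qed

lemma well_ordered_singleton: "wfp_on {r::real} (<)"
  unfolding wfp_on_iff_ex_minimal by (auto simp: subset_singleton_iff)

text \<open>
  Formal series \<open>c(t) = \<Sum>r. c\<^sub>r t\<^sup>r\<close> with well-ordered support in the reals.  A well-ordered
  set of reals is automatically bounded from below.
\<close>

typedef (overloaded) 'a puiseux = "{c :: real \<Rightarrow> 'a::zero. wfp_on {r. c r \<noteq> 0} (<)}"
  morphisms coef Puiseux
  by (rule exI[of _ "\<lambda>_. 0"]) (simp add: wfp_on_def)

setup_lifting type_definition_puiseux

lemma well_ordered_coef: "wfp_on {r. coef c r \<noteq> 0} (<)"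
  using coef[of c] by simp

lemma puiseux_eqI: "(\<And>r. coef c r = coef d r) \<Longrightarrow> c = d"
  by (metis coef_inject ext)

instantiation puiseux :: (zero) zero
begin
lift_definition zero_puiseux :: "'a puiseux" is "\<lambda>_. 0" by (simp add: wfp_on_def)
instance ..
end

lift_definition puiseux_monom :: "'a \<Rightarrow> real \<Rightarrow> 'a::zero puiseux" is "\<lambda>a s r. if r = s then a else 0"
proof -
  fix a :: 'a and s :: real
  show "wfp_on {r. (if r = s then a else 0) \<noteq> 0} (<)"
    by (rule wfp_on_subset[OF well_ordered_singleton[of s]]) auto
qed

instantiation puiseux :: (ab_group_add) ab_group_add
begin

lift_definition plus_puiseux :: "'a puiseux \<Rightarrow> 'a puiseux \<Rightarrow> 'a puiseux"
  is "\<lambda>c d r. c r + d r"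
proof -
  fix c d :: "real \<Rightarrow> 'a"
  assume "wfp_on {r. c r \<noteq> 0} (<)" "wfp_on {r. d r \<noteq> 0} (<)"
  from well_ordered_Un[OF this] show "wfp_on {r. c r + d r \<noteq> 0} (<)"
    by (rule wfp_on_subset) auto
qed

lift_definition uminus_puiseux :: "'a puiseux \<Rightarrow> 'a puiseux" is "\<lambda>c r. - c r" by simp

definition minus_puiseux :: "'a puiseux \<Rightarrow> 'a puiseux \<Rightarrow> 'a puiseux"
  where "minus_puiseux c d = c + - d"

instance
proof
  fix a b c :: "'a puiseux"
  show "a + b + c = a + (b + c)" by transfer (simp add: add_ac)
  show "a + b = b + a" by transfer (simp add: add_ac)
  show "0 + a = a" by transfer simp
  show "- a + a = 0" by transfer simp
  show "a - b = a + - b" by (simp add: minus_puiseux_def)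
qed

end

instantiation puiseux :: (comm_ring_1) comm_ring_1
begin

definition one_puiseux :: "'a puiseux" where "one_puiseux = puiseux_monom 1 0"

lift_definition times_puiseux :: "'a puiseux \<Rightarrow> 'a puiseux \<Rightarrow> 'a puiseux"
  is "\<lambda>c d r. \<Sum>p | c p \<noteq> 0 \<and> d (r - p) \<noteq> 0. c p * d (r - p)"
proof -
  fix c d :: "real \<Rightarrow> 'a"
  assume "wfp_on {r. c r \<noteq> 0} (<)" "wfp_on {r. d r \<noteq> 0} (<)"
  from well_ordered_add[OF this]
  show "wfp_on {r. (\<Sum>p | c p \<noteq> 0 \<and> d (r - p) \<noteq> 0. c p * d (r - p)) \<noteq> 0} (<)"
  proof (rule wfp_on_subset, safe)
    fix r assume "(\<Sum>p | c p \<noteq> 0 \<and> d (r - p) \<noteq> 0. c p * d (r - p)) \<noteq> 0"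
    then obtain p where "c p \<noteq> 0" "d (r - p) \<noteq> 0" by (rule sum.not_neutral_contains_not_neutral) blast
    then show "\<exists>p q. r = p + q \<and> p \<in> {r. c r \<noteq> 0} \<and> q \<in> {r. d r \<noteq> 0}"
      by (intro exI[of _ p] exI[of _ "r - p"]) auto
  qed
qed

lemma finite_coef_pairs: "finite {p. coef c p \<noteq> 0 \<and> coef d (r - p) \<noteq> 0}"
  using well_ordered_finite[OF well_ordered_coef[of c] well_ordered_coef[of d], of r] by simp

lemma coef_times:
  assumes "finite S" "{p. coef c p \<noteq> 0 \<and> coef d (r - p) \<noteq> 0} \<subseteq> S"
  shows "coef (c * d) r = (\<Sum>p\<in>S. coef c p * coef d (r - p))"
  unfolding times_puiseux.rep_eq by (rule sum.mono_neutral_left[OF assms]) auto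

lemma coef_times': "coef (c * d) r = (\<Sum>p | coef c p \<noteq> 0 \<and> coef d (r - p) \<noteq> 0. coef c p * coef d (r - p))"
  by (simp add: times_puiseux.rep_eq)

lemma coef_times_nonzeroE:
  assumes "coef (c * d) r \<noteq> 0"
  obtains p where "coef c p \<noteq> 0" "coef d (r - p) \<noteq> 0"
  using assms unfolding coef_times' by (rule sum.not_neutral_contains_not_neutral) blast

instance
proof
  fix a b c :: "'a puiseux"
  show "a * b * c = a * (b * c)"
  proof (rule puiseux_eqI)
    fix r
    define T where "T = {(p, s). coef a p \<noteq> 0 \<and> coef b s \<noteq> 0 \<and> coef c (r - p - s) \<noteq> 0}"
    define Q where "Q = {q. (\<exists>p. coef a p \<noteq> 0 \<and> coef b (q - p) \<noteq> 0) \<and> coef c (r - q) \<noteq> 0}"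
    define P where "P = {p. coef a p \<noteq> 0 \<and> (\<exists>s. coef b s \<noteq> 0 \<and> coef c (r - p - s) \<noteq> 0)}"
    have "wfp_on {p + q |p q. p \<in> {r. coef a r \<noteq> 0} \<and> q \<in> {r. coef b r \<noteq> 0}} (<)" (is "wfp_on ?ab (<)")
      by (intro well_ordered_add well_ordered_coef)
    from well_ordered_finite[OF this well_ordered_coef[of c], of r]
    have finQ: "finite Q"
      by (rule finite_subset[rotated]) (force simp: Q_def intro: exI[of _ "q - p" for q p])
    have finAB: "finite {p. coef a p \<noteq> 0 \<and> coef b (q - p) \<noteq> 0}" for q
      by (rule finite_coef_pairs)
    have T: "T = (\<lambda>(q, p). (p, q - p)) ` (SIGMA q:Q. {p. coef a p \<noteq> 0 \<and> coef b (q - p) \<noteq> 0})"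
    proof (intro equalityI subsetI)
      fix x assume "x \<in> T"
      then obtain p s where x: "x = (p, s)" and ps: "coef a p \<noteq> 0" "coef b s \<noteq> 0" "coef c (r - p - s) \<noteq> 0"
        by (auto simp: T_def)
      have "(p + s, p) \<in> (SIGMA q:Q. {p. coef a p \<noteq> 0 \<and> coef b (q - p) \<noteq> 0})"
        using ps by (auto simp: Q_def algebra_simps intro!: exI[of _ p])
      then show "x \<in> (\<lambda>(q, p). (p, q - p)) ` (SIGMA q:Q. {p. coef a p \<noteq> 0 \<and> coef b (q - p) \<noteq> 0})"
        by (rule rev_image_eqI) (simp add: x)
    qed (auto simp: T_def Q_def)
    have inj: "inj_on (\<lambda>(q::real, p). (p, q - p)) X" for X by (auto simp: inj_on_def)
    have finT: "finite T" unfolding T using finQ finAB by (intro finite_imageI finite_SigmaI)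
    have "coef (a * b * c) r = (\<Sum>q\<in>Q. coef (a * b) q * coef c (r - q))"
      by (rule coef_times[OF finQ]) (auto simp: Q_def elim: coef_times_nonzeroE)
    also have "\<dots> = (\<Sum>q\<in>Q. \<Sum>p | coef a p \<noteq> 0 \<and> coef b (q - p) \<noteq> 0. coef a p * coef b (q - p) * coef c (r - q))"
      by (simp add: coef_times' sum_distrib_right)
    also have "\<dots> = (\<Sum>(q, p)\<in>(SIGMA q:Q. {p. coef a p \<noteq> 0 \<and> coef b (q - p) \<noteq> 0}). coef a p * coef b (q - p) * coef c (r - q))"
      using finQ finAB by (subst sum.Sigma) auto
    also have "\<dots> = (\<Sum>(p, s)\<in>T. coef a p * coef b s * coef c (r - p - s))"
      unfolding T by (subst sum.reindex[OF inj]) (auto intro!: sum.cong simp: algebra_simps)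
    finally have L: "coef (a * b * c) r = (\<Sum>(p, s)\<in>T. coef a p * coef b s * coef c (r - p - s))" .
    have P: "P = fst ` T" by (force simp: P_def T_def)
    have finP: "finite P" unfolding P using finT by simp
    have finBC: "finite {s. coef b s \<noteq> 0 \<and> coef c (r - p - s) \<noteq> 0}" for p
      by (rule finite_coef_pairs)
    have "coef (a * (b * c)) r = (\<Sum>p\<in>P. coef a p * coef (b * c) (r - p))"
      by (rule coef_times[OF finP]) (auto simp: P_def elim: coef_times_nonzeroE)
    also have "\<dots> = (\<Sum>p\<in>P. \<Sum>s | coef b s \<noteq> 0 \<and> coef c (r - p - s) \<noteq> 0. coef a p * coef b s * coef c (r - p - s))"
      by (simp add: coef_times' sum_distrib_left mult.assoc)
    also have "\<dots> = (\<Sum>(p, s)\<in>(SIGMA p:P. {s. coef b s \<noteq> 0 \<and> coef c (r - p - s) \<noteq> 0}). coef a p * coef b s * coef c (r - p - s))"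
      using finP finBC by (subst sum.Sigma) auto
    also have "(SIGMA p:P. {s. coef b s \<noteq> 0 \<and> coef c (r - p - s) \<noteq> 0}) = T"
      by (auto simp: P_def T_def)
    finally show "coef (a * b * c) r = coef (a * (b * c)) r" using L by simp
  qed
  show "a * b = b * a"
  proof (rule puiseux_eqI)
    fix r
    have eq: "{p. coef a p \<noteq> 0 \<and> coef b (r - p) \<noteq> 0} = (\<lambda>p. r - p) ` {p. coef b p \<noteq> 0 \<and> coef a (r - p) \<noteq> 0}"
      by (auto intro: rev_image_eqI[of "r - x" for x])
    have "coef (a * b) r = (\<Sum>p\<in>{p. coef b p \<noteq> 0 \<and> coef a (r - p) \<noteq> 0}. coef a (r - p) * coef b p)"
      unfolding coef_times' eq by (subst sum.reindex) (auto simp: inj_on_def)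
    then show "coef (a * b) r = coef (b * a) r" by (simp add: coef_times' mult.commute)
  qed
  show "1 * a = a"
  proof (rule puiseux_eqI)
    fix r
    have "coef (1 * a) r = (\<Sum>p\<in>{0}. coef 1 p * coef a (r - p))"
      by (rule coef_times) (auto simp: one_puiseux_def puiseux_monom.rep_eq split: if_splits)
    then show "coef (1 * a) r = coef a r" by (simp add: one_puiseux_def puiseux_monom.rep_eq)
  qed
  show "(a + b) * c = a * c + b * c"
  proof (rule puiseux_eqI)
    fix r
    define S where "S = {p. coef a p \<noteq> 0 \<and> coef c (r - p) \<noteq> 0} \<union> {p. coef b p \<noteq> 0 \<and> coef c (r - p) \<noteq> 0}"
    have S: "finite S" unfolding S_def by (intro finite_UnI finite_coef_pairs)
    have "coef ((a + b) * c) r = (\<Sum>p\<in>S. coef (a + b) p * coef c (r - p))"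
      by (rule coef_times[OF S]) (auto simp: S_def plus_puiseux.rep_eq)
    also have "\<dots> = (\<Sum>p\<in>S. coef a p * coef c (r - p)) + (\<Sum>p\<in>S. coef b p * coef c (r - p))"
      by (simp add: plus_puiseux.rep_eq distrib_right sum.distrib)
    also have "\<dots> = coef (a * c + b * c) r"
      unfolding plus_puiseux.rep_eq by (subst (1 2) coef_times[OF S]) (auto simp: S_def)
    finally show "coef ((a + b) * c) r = coef (a * c + b * c) r" .
  qed
  have "coef 0 0 = (0::'a)" "coef 1 0 = (1::'a)"
    by (simp_all add: one_puiseux_def puiseux_monom.rep_eq zero_puiseux.rep_eq)
  then show "(0::'a puiseux) \<noteq> 1" by (metis zero_neq_one)
qed

end


lemma coef_diff: "coef (a - b) r = coef a r - coef b r" for a b :: "'a::ab_group_add puiseux"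
  unfolding minus_puiseux_def plus_puiseux.rep_eq uminus_puiseux.rep_eq by simp

lemma coef_times_cong:
  fixes c :: "'a::comm_ring_1 puiseux"
  assumes "\<And>p. p < 0 \<Longrightarrow> coef c p = 0" "\<And>q. q \<le> r \<Longrightarrow> coef x q = coef y q"
  shows "coef (c * x) r = coef (c * y) r"
proof -
  have nn: "0 \<le> p" if "coef c p \<noteq> 0" for p
    using assms(1)[of p] that by force
  have "coef x (r - p) = coef y (r - p)" if "coef c p \<noteq> 0" for p
    using assms(2)[of "r - p"] nn[OF that] by simp
  then show ?thesis unfolding coef_times' by (intro sum.cong) auto
qed

lemma coef_power_below:
  fixes u :: "'a::comm_ring_1 puiseux"
  assumes "\<And>p. p < m \<Longrightarrow> coef u p = 0"
  shows "r < real j * m \<Longrightarrow> coef (u ^ j) r = 0"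
proof (induction j arbitrary: r)
  case 0
  then show ?case by (simp add: one_puiseux_def puiseux_monom.rep_eq)
next
  case (Suc j)
  show ?case
  proof (rule ccontr)
    assume "coef (u ^ Suc j) r \<noteq> 0"
    then have "coef (u * u ^ j) r \<noteq> 0" by simp
    then obtain p where "coef u p \<noteq> 0" "coef (u ^ j) (r - p) \<noteq> 0" by (rule coef_times_nonzeroE)
    then have "m \<le> p" "real j * m \<le> r - p" using assms[of p] Suc.IH[of "r - p"] by linarith+
    then show False using Suc.prems by (simp add: algebra_simps)
  qed
qed

lemma puiseux_geometric_inverse:
  fixes u :: "'a::comm_ring_1 puiseux"
  assumes m: "m > 0" and u: "\<And>p. p < m \<Longrightarrow> coef u p = 0"
  shows "\<exists>d. (1 - u) * d = 1"
proof -
  define D where "D k = (\<Sum>j<k. u ^ j)" for k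
  define N where "N r = Suc (nat \<lfloor>r / m\<rfloor>)" for r :: real
  have Nmono: "N q \<le> N r" if "q \<le> r" for q r
    using that m by (auto simp: N_def intro!: nat_mono floor_mono divide_right_mono)
  have Ngt: "r < real k * m" if "N r \<le> k" for r k
  proof -
    have "r / m < real (N r)" unfolding N_def by linarith
    also have "\<dots> \<le> real k" using that by simp
    finally show ?thesis using m by (simp add: field_simps)
  qed
  have stable: "coef (D k) r = coef (D (N r)) r" if "N r \<le> k" for k r
    using that
  proof (induction k rule: dec_induct)
    case (step k)
    then show ?case
      using coef_power_below[where u = u and m = m, OF u Ngt[of r k]]
      by (simp add: D_def plus_puiseux.rep_eq)
  qed simp
  have wo: "wfp_on {r. coef (D (N r)) r \<noteq> 0} (<)"
  proof (rule well_orderedI_no_descent)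
    fix s :: "nat \<Rightarrow> real"
    assume s: "\<And>n. s n \<in> {r. coef (D (N r)) r \<noteq> 0}" and desc: "\<And>n. s (Suc n) < s n"
    have "s n \<le> s 0" for n
    proof (induction n)
      case (Suc n)
      then show ?case using desc[of n] by linarith
    qed simp
    then have "coef (D (N (s 0))) (s n) \<noteq> 0" for n
      using s[of n] stable[OF Nmono[of "s n" "s 0"]] by simp
    then show False
      using well_ordered_no_descent[OF well_ordered_coef[of "D (N (s 0))"]] desc by blast
  qed
  define d where "d = Puiseux (\<lambda>r. coef (D (N r)) r)"
  have d: "coef d r = coef (D (N r)) r" for r
    unfolding d_def using wo by (subst Puiseux_inverse) auto
  have "(1 - u) * d = 1"
  proof (rule puiseux_eqI)
    fix r
    have "coef ((1 - u) * d) r = coef ((1 - u) * D (N r)) r"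
    proof (rule coef_times_cong)
      show "coef (1 - u) p = 0" if "p < 0" for p
        using that u[of p] m by (simp add: coef_diff one_puiseux_def puiseux_monom.rep_eq)
      show "coef d q = coef (D (N r)) q" if "q \<le> r" for q
        unfolding d using stable[OF Nmono[OF that]] by simp
    qed
    also have "(1 - u) * D (N r) = 1 - u ^ N r"
      unfolding D_def by (simp add: one_diff_power_eq)
    also have "coef \<dots> r = coef 1 r"
      using coef_power_below[where u = u and m = m, OF u Ngt[of r "N r"]] by (simp add: coef_diff)
    finally show "coef ((1 - u) * d) r = coef 1 r" .
  qed
  then show ?thesis by blast
qed

lemma coef_monom_times:
  fixes c :: "'a::comm_ring_1 puiseux"
  shows "coef (puiseux_monom a s * c) r = a * coef c (r - s)"
proof -
  have "coef (puiseux_monom a s * c) r = (\<Sum>p\<in>{s}. coef (puiseux_monom a s) p * coef c (r - p))"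
    by (rule coef_times) (auto simp: puiseux_monom.rep_eq split: if_splits)
  then show ?thesis by (simp add: puiseux_monom.rep_eq)
qed

lemma puiseux_inverse_exists:
  fixes c :: "'a::field puiseux"
  assumes "c \<noteq> 0"
  shows "\<exists>d. c * d = 1"
proof -
  have ex: "\<exists>z\<in>{r. coef x r \<noteq> 0}. \<forall>y. y < z \<longrightarrow> coef x y = 0" if "x \<noteq> 0" for x :: "'a puiseux"
  proof -
    have "{r. coef x r \<noteq> 0} \<noteq> {}"
      using that puiseux_eqI[of x 0] by (auto simp: zero_puiseux.rep_eq)
    then show ?thesis using well_ordered_coef[of x] unfolding wfp_on_iff_ex_minimal by blast
  qed
  obtain z where z: "coef c z \<noteq> 0" "\<And>y. y < z \<Longrightarrow> coef c y = 0" using ex[OF assms] by blast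
  define w where "w = puiseux_monom (1 / coef c z) (- z)"
  define u where "u = 1 - w * c"
  have u0: "coef u p = 0" if "p \<le> 0" for p
    using that z by (auto simp: u_def w_def coef_diff coef_monom_times one_puiseux_def puiseux_monom.rep_eq)
  have "\<exists>m>0. \<forall>p<m. coef u p = 0"
  proof (cases "u = 0")
    case True
    then show ?thesis by (intro exI[of _ 1]) (simp add: zero_puiseux.rep_eq)
  next
    case False
    then obtain m where m: "coef u m \<noteq> 0" "\<forall>y. y < m \<longrightarrow> coef u y = 0" using ex[OF False] by blast
    moreover have "m > 0" using m(1) u0[of m] by linarith
    ultimately show ?thesis by blast
  qed
  then obtain m where "m > 0" "\<And>p. p < m \<Longrightarrow> coef u p = 0" by blast
  from puiseux_geometric_inverse[OF this] obtain d where "(1 - u) * d = 1" by blast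
  then have "c * (w * d) = 1" by (simp add: u_def mult.left_commute mult.assoc)
  then show ?thesis by blast
qed

instantiation puiseux :: (field) field
begin

definition inverse_puiseux :: "'a puiseux \<Rightarrow> 'a puiseux"
  where "inverse_puiseux c = (if c = 0 then 0 else (SOME d. c * d = 1))"

definition divide_puiseux :: "'a puiseux \<Rightarrow> 'a puiseux \<Rightarrow> 'a puiseux"
  where "divide_puiseux c d = c * inverse d"

instance
proof
  fix a b :: "'a puiseux"
  show "inverse a * a = 1" if "a \<noteq> 0"
  proof -
    have "inverse a = (SOME d. a * d = 1)" using that by (simp add: inverse_puiseux_def)
    then have "a * inverse a = 1" using someI_ex[OF puiseux_inverse_exists[OF that]] by simp
    then show ?thesis by (simp only: mult.commute)
  qed
  show "a div b = a * inverse b" by (rule divide_puiseux_def)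
  show "inverse (0 :: 'a puiseux) = 0" by (simp add: inverse_puiseux_def)
qed

end

definition val :: "'a::zero puiseux \<Rightarrow> ereal"
  where "val c = (if c = 0 then - \<infinity> else - ereal (LEAST r. coef c r \<noteq> 0))"


section \<open>Polynomials and algebraic subsets of the torus\<close>

text \<open>
  Polynomials in variables indexed by \<open>'n\<close> are finitely supported functions on the
  exponent vectors; \<open>keys p\<close> is the support of \<open>p\<close> and \<open>lookup p a\<close> the coefficient of \<open>z\<^sup>a\<close>.
\<close>

type_synonym ('n, 'a) mpolynomial = "(nat ^ 'n) \<Rightarrow>\<^sub>0 'a"

definition mpoly_eval :: "('n::finite, 'a::field) mpolynomial \<Rightarrow> 'a ^ 'n \<Rightarrow> 'a"
  where "mpoly_eval p z =
    (\<Sum>a\<in>Poly_Mapping.keys p. Poly_Mapping.lookup p a * (\<Prod>l\<in>UNIV. (z $ l) ^ (a $ l)))"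

text \<open>The value at \<open>z\<close> of the formal partial derivative of \<open>p\<close> with respect to the \<open>j\<close>-th variable.\<close>

definition mpoly_partial :: "'n \<Rightarrow> ('n::finite, 'a::field) mpolynomial \<Rightarrow> 'a ^ 'n \<Rightarrow> 'a"
  where "mpoly_partial j p z =
    (\<Sum>a\<in>Poly_Mapping.keys p. Poly_Mapping.lookup p a * of_nat (a $ j) *
      (\<Prod>l\<in>UNIV. (z $ l) ^ (if l = j then a $ l - 1 else a $ l)))"

definition torus :: "('a::field ^ 'n::finite) set"
  where "torus = {z. \<forall>l. z $ l \<noteq> 0}"

definition torus_zeros :: "('n::finite, 'a::field) mpolynomial set \<Rightarrow> ('a ^ 'n) set"
  where "torus_zeros S = {z \<in> torus. \<forall>p\<in>S. mpoly_eval p z = 0}"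

definition zariski_closed :: "('a::field ^ 'n::finite) set \<Rightarrow> bool"
  where "zariski_closed X \<longleftrightarrow> (\<exists>S. X = torus_zeros S)"

text \<open>The empty set counts as irreducible here.\<close>

definition zariski_irreducible :: "('a::field ^ 'n::finite) set \<Rightarrow> bool"
  where "zariski_irreducible X \<longleftrightarrow> zariski_closed X \<and>
    (\<forall>Y Z. zariski_closed Y \<and> zariski_closed Z \<and> X = Y \<union> Z \<longrightarrow> X = Y \<or> X = Z)"

text \<open>Krull dimension of the Zariski topology (only meaningful for nonempty sets).\<close>

definition zariski_dim :: "('a::field ^ 'n::finite) set \<Rightarrow> enat"
  where "zariski_dim X =
    (SUP k \<in> {k. \<exists>Z :: nat \<Rightarrow> ('a ^ 'n) set.
        (\<forall>i\<le>k. zariski_irreducible (Z i) \<and> Z i \<noteq> {} \<and> Z i \<subseteq> X) \<and> (\<forall>i<k. Z i \<subset> Z (Suc i))}. enat k)"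

definition vanishing_ideal :: "('a::field ^ 'n::finite) set \<Rightarrow> ('n, 'a) mpolynomial set"
  where "vanishing_ideal X = {p. \<forall>z\<in>X. mpoly_eval p z = 0}"

definition tangent_space :: "('a::field ^ 'n::finite) set \<Rightarrow> 'a ^ 'n \<Rightarrow> ('a ^ 'n) set"
  where "tangent_space X z =
    {v. \<forall>p\<in>vanishing_ideal X. (\<Sum>j\<in>UNIV. mpoly_partial j p z * v $ j) = 0}"

text \<open>
  Smoothness of an equidimensional algebraic subset of the torus: it is used below only
  together with irreducibility.
\<close>

definition smooth_set :: "('a::field ^ 'n::finite) set \<Rightarrow> bool"
  where "smooth_set X \<longleftrightarrow> (\<forall>z\<in>X. enat (vec.dim (tangent_space X z)) = zariski_dim X)"

text \<open>
  The members \<open>g i\<close>, \<open>i \<in> I\<close>, form a complete intersection in the torus: they generate the ideal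
  of their common zero set in the ring of Laurent polynomials (whence the monomial factor
  \<open>z\<^sup>m\<close>, which is a unit there), and this set is empty or of codimension \<open>card I\<close>.
\<close>

definition complete_intersection ::
    "'n set \<Rightarrow> ('n \<Rightarrow> ('n::finite, 'a::field) mpolynomial) \<Rightarrow> bool"
  where "complete_intersection I g \<longleftrightarrow>
    (\<forall>p\<in>vanishing_ideal (torus_zeros (g ` I)).
        \<exists>m h. Poly_Mapping.single m 1 * p = (\<Sum>i\<in>I. h i * g i)) \<and>
    (torus_zeros (g ` I) = {} \<or>
      zariski_dim (torus_zeros (g ` I)) + enat (card I) = enat CARD('n))"


section \<open>Tropical polynomials and tropical maps\<close>

definition real_exponent :: "nat ^ 'n::finite \<Rightarrow> real ^ 'n"
  where "real_exponent a = (\<chi> l. real (a $ l))"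

definition tropical_term ::
    "('n::finite, 'k::field puiseux) mpolynomial \<Rightarrow> real ^ 'n \<Rightarrow> nat ^ 'n \<Rightarrow> real"
  where "tropical_term p x a =
    inner x (real_exponent a) + real_of_ereal (val (Poly_Mapping.lookup p a))"

text \<open>For the zero polynomial, whose tropicalization would be \<open>-\<infinity>\<close>, the value is unspecified.\<close>

definition tropical_poly :: "('n::finite, 'k::field puiseux) mpolynomial \<Rightarrow> real ^ 'n \<Rightarrow> real"
  where "tropical_poly p x = Max (tropical_term p x ` Poly_Mapping.keys p)"

definition tropical_map ::
    "('n \<Rightarrow> ('n::finite, 'k::field puiseux) mpolynomial) \<Rightarrow> real ^ 'n \<Rightarrow> real ^ 'n"
  where "tropical_map f x = (\<chi> i. tropical_poly (f i) x)"

definition maximal_exponents ::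
    "('n::finite, 'k::field puiseux) mpolynomial \<Rightarrow> real ^ 'n \<Rightarrow> (nat ^ 'n) set"
  where "maximal_exponents p x =
    {a \<in> Poly_Mapping.keys p. tropical_poly p x = tropical_term p x a}"

definition cell_decomposition ::
    "('n \<Rightarrow> ('n::finite, 'k::field puiseux) mpolynomial) \<Rightarrow> (real ^ 'n) set set"
  where "cell_decomposition f =
    UNIV // {(x, x'). \<forall>i. maximal_exponents (f i) x = maximal_exponents (f i) x'}"

definition virtual_preimage :: "(real ^ 'n::finite \<Rightarrow> real ^ 'n) \<Rightarrow> real ^ 'n \<Rightarrow> (real ^ 'n) set"
  where "virtual_preimage F y =
    {x. \<forall>i. \<not> (\<lambda>x'. max (F x' $ i) (y $ i)) differentiable (at x)}"

definition dicritical :: "real ^ 'n::finite \<Rightarrow> bool"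
  where "dicritical \<alpha> \<longleftrightarrow> (\<exists>i j. \<alpha> $ i > 0 \<and> \<alpha> $ j \<le> 0)"

definition tropical_nonproper_set :: "(real ^ 'n::finite \<Rightarrow> real ^ 'n) \<Rightarrow> (real ^ 'n) set"
  where "tropical_nonproper_set F =
    {y. \<exists>p \<alpha>. dicritical \<alpha> \<and> (\<lambda>t. p + t *\<^sub>R \<alpha>) ` {0..} \<subseteq> virtual_preimage F y}"

definition cell_values :: "(real ^ 'n::finite \<Rightarrow> real ^ 'n) \<Rightarrow> (real ^ 'n) set \<Rightarrow> (real ^ 'n) set"
  where "cell_values F \<xi> = {y. virtual_preimage F y \<inter> \<xi> \<noteq> {}}"


section \<open>Tuple-faces and face-genericity\<close>

definition newton_polytope :: "('n \<Rightarrow> (nat ^ 'n::finite) set) \<Rightarrow> 'n \<Rightarrow> (real ^ 'n) set"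
  where "newton_polytope A i = convex hull (insert 0 (real_exponent ` A i))"

text \<open>Sums of sets are Minkowski sums, and faces of polytopes are nonempty.\<close>

definition tuple_face :: "('n \<Rightarrow> (nat ^ 'n::finite) set) \<Rightarrow> ('n \<Rightarrow> (real ^ 'n) set) \<Rightarrow> bool"
  where "tuple_face A \<Gamma> \<longleftrightarrow>
    (\<forall>i. \<Gamma> i \<noteq> {} \<and> \<Gamma> i face_of newton_polytope A i) \<and>
    (\<Sum>i\<in>UNIV. \<Gamma> i) face_of (\<Sum>i\<in>UNIV. newton_polytope A i)"

definition face_part ::
    "(real ^ 'n) set \<Rightarrow> ('n::finite, 'a::field) mpolynomial \<Rightarrow> ('n, 'a) mpolynomial"
  where "face_part G p = Poly_Mapping.mapp (\<lambda>a c. if real_exponent a \<in> G then c else 0) p"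

definition face_tuple ::
    "('n \<Rightarrow> (real ^ 'n) set) \<Rightarrow> ('n \<Rightarrow> ('n::finite, 'a::field) mpolynomial) \<Rightarrow>
      'n \<Rightarrow> ('n, 'a) mpolynomial"
  where "face_tuple \<Gamma> f = (\<lambda>i. face_part (\<Gamma> i) (f i))"

text \<open>
  For a tuple-face \<open>\<Gamma>\<close>, this fails exactly if \<open>\<Gamma> i = {0}\<close> for some \<open>i \<in> I\<close>.  Then the sum defining
  \<open>f\<^sub>i\<^sub>\<Gamma>\<close> is empty.  The origin was added to \<open>A i\<close> to account for the constant term of \<open>f\<^sub>i - y\<^sub>i\<close>,
  so that the part of a polynomial at the face \<open>{0}\<close> is a nonzero constant and has no zeros;
  then the genericity conditions on a tuple with such a member are void or follow from those
  on the tuple without that member.  (Reading the part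
  as the zero polynomial instead would make them unsatisfiable: \<open>{0}\<close> is always a
  face, and it has dimension \<open>0 < 1\<close>, but the zero set would be the whole torus.)
  The conditions below are accordingly imposed on the other tuples only.
\<close>

definition has_monomials ::
    "('n \<Rightarrow> (nat ^ 'n::finite) set) \<Rightarrow> 'n set \<Rightarrow> ('n \<Rightarrow> (real ^ 'n) set) \<Rightarrow> bool"
  where "has_monomials A I \<Gamma> \<longleftrightarrow> (\<forall>i\<in>I. \<exists>a\<in>A i. real_exponent a \<in> \<Gamma> i)"

definition almost_face_generic ::
    "('n \<Rightarrow> (nat ^ 'n::finite) set) \<Rightarrow> ('n \<Rightarrow> ('n, 'a::field) mpolynomial) \<Rightarrow> bool"
  where "almost_face_generic A f \<longleftrightarrow>
    (\<forall>\<Gamma>. tuple_face A \<Gamma> \<longrightarrow>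
      (\<forall>\<Gamma>'. tuple_face A \<Gamma>' \<and> \<Gamma>' \<noteq> \<Gamma> \<and> has_monomials A UNIV \<Gamma> \<and> has_monomials A UNIV \<Gamma>' \<and>
          torus_zeros (range (face_tuple \<Gamma> f)) = torus_zeros (range (face_tuple \<Gamma>' f)) \<longrightarrow>
          torus_zeros (range (face_tuple \<Gamma> f)) = {}) \<and>
      (\<forall>I. has_monomials A I \<Gamma> \<longrightarrow>
          smooth_set (torus_zeros (face_tuple \<Gamma> f ` I)) \<and>
          zariski_irreducible (torus_zeros (face_tuple \<Gamma> f ` I)) \<and>
          complete_intersection I (face_tuple \<Gamma> f) \<and>
          (int (card I) > aff_dim (\<Sum>i\<in>I. \<Gamma> i) \<longrightarrow> torus_zeros (face_tuple \<Gamma> f ` I) = {})))"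

definition transversal_tropical_intersection ::
    "'n set \<Rightarrow> ('n \<Rightarrow> ('n::finite, 'k::field puiseux) mpolynomial) \<Rightarrow> bool"
  where "transversal_tropical_intersection I g \<longleftrightarrow>
    (\<forall>x. aff_dim (\<Sum>i\<in>I. convex hull (real_exponent ` maximal_exponents (g i) x)) =
      (\<Sum>i\<in>I. aff_dim (convex hull (real_exponent ` maximal_exponents (g i) x))))"

definition face_generic ::
    "('n \<Rightarrow> (nat ^ 'n::finite) set) \<Rightarrow> ('n \<Rightarrow> ('n, 'k::field puiseux) mpolynomial) \<Rightarrow> bool"
  where "face_generic A f \<longleftrightarrow> almost_face_generic A f \<and>
    (\<forall>\<Gamma> I. tuple_face A \<Gamma> \<and> has_monomials A I \<Gamma> \<longrightarrow>
      transversal_tropical_intersection I (face_tuple \<Gamma> f))"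

end

theory Submission
  imports Defs
begin

section \<open>Projections of polyhedra\<close>

text \<open>A maximum of affine functions with distinct slopes is differentiable exactly where a
  single one of them attains it (\<open>Max_affine_differentiable_iff\<close>). The constant
  \<open>y $ i\<close> is an affine function of slope 0, distinct from the terms of
  \<open>f i\<close> as these have nonzero exponents. Hence \<open>x\<close> lies in the virtual
  preimage of \<open>y\<close> iff, for every \<open>i\<close>, \<open>y $ i\<close> is at most the
  i-th component of F at \<open>x\<close>, with equality when a single exponent is maximal there
  (\<open>mem_virtual_preimage_iff\<close>). Over one cell the set of maximal exponents is fixed, so
  these conditions are linear in the pair of \<open>x\<close> and \<open>y\<close>.

  Closures (\<open>polyhedron_closure_cell_values\<close>): the pairs with \<open>x\<close> in the
  cell form a set W cut out by weak and strict linear inequalities, and the values of the cell are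
  its projection. Weakening the strict inequalities gives a polyhedron P with W dense in it. The
  projection of P is again a polyhedron (\<open>polyhedron_snd_image\<close>), hence closed, hence
  the closure sought.

  Union (\<open>nonproper_point_in_cell_values\<close>): there are finitely many cells, so a
  dicritical half-line in the virtual preimage of \<open>y\<close> meets one of them infinitely
  often. Its direction then yields a half-line in the virtual preimage of every other value of that
  cell, so all these values are non-proper. The cells whose values are all non-proper therefore
  cover the non-properness set. If some \<open>f i\<close> is zero, virtual preimages are empty and
  the empty family works.\<close>

lemma exists_common_slope_iff:
  fixes p q r :: "'h \<Rightarrow> real"
  assumes "finite H"
  shows "(\<exists>t. \<forall>h\<in>H. p h + t * q h \<le> r h) \<longleftrightarrow>
    (\<forall>h\<in>{h\<in>H. q h = 0}. p h \<le> r h) \<and>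
    (\<forall>(h, k)\<in>{h\<in>H. q h > 0} \<times> {k\<in>H. q k < 0}. - q k * p h + q h * p k \<le> - q k * r h + q h * r k)"
    (is "?L \<longleftrightarrow> ?Z \<and> ?P")
proof
  assume ?L
  then obtain t where t: "\<And>h. h \<in> H \<Longrightarrow> p h + t * q h \<le> r h" by blast
  \<comment> \<open>Here \<open>h\<close> bounds \<open>t\<close> from above and \<open>k\<close>
    from below; weighting them by the positive numbers \<open>- q k\<close> and \<open>q h\<close>
    cancels \<open>t\<close>.\<close>
  have "- q k * p h + q h * p k \<le> - q k * r h + q h * r k"
    if "h \<in> H" "q h > 0" "k \<in> H" "q k < 0" for h k
  proof -
    have "- q k * (p h + t * q h) + q h * (p k + t * q k) \<le> - q k * r h + q h * r k"
      by (intro add_mono mult_left_mono t) (use that in auto)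
    then show ?thesis by (simp add: algebra_simps)
  qed
  then show "?Z \<and> ?P" using t by force
next
  assume *: "?Z \<and> ?P"
  define b where "b h = (r h - p h) / q h" for h
  define U where "U = b ` {h\<in>H. q h > 0}"
  define L where "L = b ` {h\<in>H. q h < 0}"
  have fin: "finite U" "finite L" using assms by (auto simp: U_def L_def)
  have LU: "l \<le> u" if lu: "l \<in> L" "u \<in> U" for l u
  proof -
    obtain h k where hk: "h \<in> H" "q h > 0" "u = b h" "k \<in> H" "q k < 0" "l = b k"
      using lu unfolding U_def L_def by blast
    then have "- q k * p h + q h * p k \<le> - q k * r h + q h * r k" using * by auto
    then have "(r k - p k) * q h \<ge> (r h - p h) * q k" by (simp add: algebra_simps)
    then show ?thesis using hk(2,5) unfolding hk(3,6) b_def by (simp add: divide_simps)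
  qed
  \<comment> \<open>Any number between the largest lower bound and the smallest upper bound works;
    the cases are those where one kind of bound is absent.\<close>
  obtain t where t: "\<And>l. l \<in> L \<Longrightarrow> l \<le> t" "\<And>u. u \<in> U \<Longrightarrow> t \<le> u"
  proof (cases "L = {}")
    case True
    show ?thesis
    proof (cases "U = {}")
      case False
      then show ?thesis using True that[of "Min U"] fin by simp
    qed (use True that in auto)
  next
    case False
    then have "Max L \<in> L" using fin by simp
    then show ?thesis using that[of "Max L"] fin LU by auto
  qed
  have "p h + t * q h \<le> r h" if "h \<in> H" for h
  proof (cases "q h" "0::real" rule: linorder_cases)
    case less
    then have "b h \<le> t" using t(1) that by (auto simp: L_def)
    then show ?thesis using less by (simp add: b_def divide_simps)
  next
    case equal
    then show ?thesis using * that by simp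
  next
    case greater
    then have "t \<le> b h" using t(2) that by (auto simp: U_def)
    then show ?thesis using greater by (simp add: b_def divide_simps)
  qed
  then show ?L by blast
qed

section \<open>Polyhedra under intersection, linear preimage and projection\<close>

lemma polyhedron_Collect_ball:
  fixes P :: "'h \<Rightarrow> 'a::euclidean_space \<Rightarrow> bool"
  assumes "finite H" "\<And>h. h \<in> H \<Longrightarrow> polyhedron {x. P h x}"
  shows "polyhedron {x. \<forall>h\<in>H. P h x}"
proof -
  have "{x. \<forall>h\<in>H. P h x} = (\<Inter>h\<in>H. {x. P h x})" by auto
  then show ?thesis using assms by (simp only:) (rule polyhedron_Inter; auto)
qed

lemma polyhedron_linear_vimage:
  fixes f :: "'a::euclidean_space \<Rightarrow> 'b::euclidean_space"
  assumes "linear f" "polyhedron S"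
  shows "polyhedron (f -` S)"
proof -
  obtain H where H: "finite H" "S = \<Inter>H" "\<forall>h\<in>H. \<exists>a b. a \<noteq> 0 \<and> h = {x. a \<bullet> x \<le> b}"
    using assms(2) unfolding polyhedron_def by blast
  have "polyhedron {x. f x \<in> h}" if "h \<in> H" for h
  proof -
    from bspec[OF H(3) that] obtain a b where "h = {x. a \<bullet> x \<le> b}" by (elim exE conjE)
    \<comment> \<open>The adjoint moves the normal vector to the source space. It may become 0
      there, which still gives a polyhedron, namely everything or nothing.\<close>
    moreover have "a \<bullet> f x = adjoint f a \<bullet> x" for x
      using adjoint_works[OF assms(1)] by (metis inner_commute)
    ultimately have "{x. f x \<in> h} = {x. adjoint f a \<bullet> x \<le> b}" by simp
    then show ?thesis by (simp add: polyhedron_halfspace_le)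
  qed
  then have "polyhedron {x. \<forall>h\<in>H. f x \<in> h}" by (rule polyhedron_Collect_ball[OF H(1)])
  then show ?thesis by (simp add: H(2) vimage_def)
qed

lemma polyhedron_linear_le:
  fixes l m :: "'a::euclidean_space \<Rightarrow> real"
  assumes "linear l" "linear m"
  shows "polyhedron {z. l z + c \<le> m z + d}"
proof -
  have "polyhedron ((\<lambda>z. l z - m z) -` {t. 1 \<bullet> t \<le> d - c})"
    by (intro polyhedron_linear_vimage polyhedron_halfspace_le linear_compose_sub assms)
  then show ?thesis by (simp add: vimage_def algebra_simps)
qed

text \<open>Fourier--Motzkin elimination of a single direction.\<close>

lemma polyhedron_add_line:
  fixes S :: "'a::euclidean_space set"
  assumes "polyhedron S"
  shows "polyhedron {x. \<exists>t. x + t *\<^sub>R v \<in> S}"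
proof -
  obtain H where H: "finite H" "S = \<Inter>H" "\<forall>h\<in>H. \<exists>a b. a \<noteq> 0 \<and> h = {x. a \<bullet> x \<le> b}"
    using assms unfolding polyhedron_def by blast
  then obtain a b where ab: "\<And>h. h \<in> H \<Longrightarrow> h = {x. a h \<bullet> x \<le> b h}" by metis
  \<comment> \<open>\<open>Z\<close> collects the constraints that do not involve \<open>t\<close>,
    \<open>Q\<close> the pairs of an upper and a lower bound on \<open>t\<close>; \<open>u\<close>
    and \<open>c\<close> are the two sides of the combination in which \<open>t\<close>
    cancels.\<close>
  define Z where "Z = {h\<in>H. a h \<bullet> v = 0}"
  define Q where "Q = {h\<in>H. a h \<bullet> v > 0} \<times> {k\<in>H. a k \<bullet> v < 0}"
  define u where "u = (\<lambda>(h, k). - (a k \<bullet> v) *\<^sub>R a h + (a h \<bullet> v) *\<^sub>R a k)"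
  define c where "c = (\<lambda>(h, k). - (a k \<bullet> v) * b h + (a h \<bullet> v) * b k)"
  have fin: "finite Z" "finite Q" using H(1) by (auto simp: Z_def Q_def)
  have S: "x \<in> S \<longleftrightarrow> (\<forall>h\<in>H. a h \<bullet> x \<le> b h)" for x using H(2) ab by blast
  have "(\<exists>t. x + t *\<^sub>R v \<in> S) \<longleftrightarrow> (\<forall>h\<in>Z. a h \<bullet> x \<le> b h) \<and> (\<forall>w\<in>Q. u w \<bullet> x \<le> c w)" for x
    using exists_common_slope_iff[OF H(1), of "\<lambda>h. a h \<bullet> x" "\<lambda>h. a h \<bullet> v" b]
    by (simp add: S Z_def Q_def u_def c_def inner_add_left inner_add_right inner_diff_left split_beta)
  then have "{x. \<exists>t. x + t *\<^sub>R v \<in> S} = {x. \<forall>h\<in>Z. a h \<bullet> x \<le> b h} \<inter> {x. \<forall>w\<in>Q. u w \<bullet> x \<le> c w}"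
    by auto
  then show ?thesis
    by (simp add: polyhedron_Collect_ball fin polyhedron_halfspace_le)
qed

text \<open>Projecting amounts to saturating \<open>S\<close> by all vectors \<open>(w, 0)\<close>
  and slicing at first component 0. The saturation is done one basis vector at a time, each step
  being an elimination of one direction.\<close>

lemma polyhedron_snd_image:
  fixes S :: "('a::euclidean_space \<times> 'b::euclidean_space) set"
  assumes "polyhedron S"
  shows "polyhedron (snd ` S)"
proof -
  have "polyhedron {z. \<exists>w\<in>span B. z + (w, 0) \<in> S}" if "finite B" for B
    using that
  proof (induction B)
    case empty
    then show ?case using assms by (simp flip: zero_prod_def)
  next
    case (insert b B)
    have "(\<exists>w\<in>span (insert b B). z + (w, 0) \<in> S) \<longleftrightarrow>
        (\<exists>t. \<exists>w\<in>span B. z + t *\<^sub>R (b, 0) + (w, 0) \<in> S)" for z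
    proof
      assume "\<exists>w\<in>span (insert b B). z + (w, 0) \<in> S"
      then obtain w t where "z + (w, 0) \<in> S" "w - t *\<^sub>R b \<in> span B" by (auto simp: span_insert)
      then show "\<exists>t. \<exists>w\<in>span B. z + t *\<^sub>R (b, 0) + (w, 0) \<in> S"
        by (intro exI[of _ t] bexI[of _ "w - t *\<^sub>R b"]) (auto simp: add.assoc)
    next
      assume "\<exists>t. \<exists>w\<in>span B. z + t *\<^sub>R (b, 0) + (w, 0) \<in> S"
      then obtain t w where "w \<in> span B" "z + t *\<^sub>R (b, 0) + (w, 0) \<in> S" by blast
      then show "\<exists>w\<in>span (insert b B). z + (w, 0) \<in> S"
        by (intro bexI[of _ "t *\<^sub>R b + w"]) (auto simp: add.assoc span_insert intro: exI[of _ t])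
    qed
    then show ?case using polyhedron_add_line[OF insert.IH, of "(b, 0)"] by simp
  qed
  from this[of Basis] have "polyhedron {z. \<exists>w. z + (w, 0) \<in> S}" by simp
  then have "polyhedron ((\<lambda>y. (0, y)) -` {z. \<exists>w. z + (w, 0) \<in> S})"
    by (rule polyhedron_linear_vimage[rotated]) (simp add: linear_iff)
  moreover have "(\<lambda>y. (0, y)) -` {z. \<exists>w. z + (w, 0) \<in> S} = snd ` S" by force
  ultimately show ?thesis by simp
qed

text \<open>The points with parameter \<open>1 / (n + 1)\<close> tend to \<open>z\<close>. In the
  application \<open>z\<close> satisfies weak inequalities and \<open>w\<close> their strict
  versions.\<close>

lemma closure_if_segments:
  fixes z w :: "'a::real_normed_vector"
  assumes "\<And>e. 0 < e \<Longrightarrow> e \<le> 1 \<Longrightarrow> (1 - e) *\<^sub>R z + e *\<^sub>R w \<in> W"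
  shows "z \<in> closure W"
  unfolding closure_sequential
proof (intro exI conjI allI)
  let ?e = "\<lambda>n. inverse (real (Suc n))"
  show "(1 - ?e n) *\<^sub>R z + ?e n *\<^sub>R w \<in> W" for n by (rule assms) (auto simp: divide_simps)
  have "(\<lambda>n. (1 - ?e n) *\<^sub>R z + ?e n *\<^sub>R w) \<longlonglongrightarrow> (1 - 0) *\<^sub>R z + 0 *\<^sub>R w"
    by (intro tendsto_intros LIMSEQ_inverse_real_of_nat)
  then show "(\<lambda>n. (1 - ?e n) *\<^sub>R z + ?e n *\<^sub>R w) \<longlonglongrightarrow> z" by simp
qed

section \<open>Virtual preimages\<close>

text \<open>A single active function coincides with the maximum near \<open>x\<close>. Conversely,
  the derivative at \<open>x\<close> must equal the gradient of every active function, and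
  injectivity of \<open>v\<close> leaves room for only one.\<close>

lemma Max_affine_differentiable_iff:
  fixes v :: "'s \<Rightarrow> 'a::real_inner"
  assumes "finite S" "S \<noteq> {}" "inj_on v S"
  shows "(\<lambda>x. Max ((\<lambda>s. x \<bullet> v s + c s) ` S)) differentiable (at x) \<longleftrightarrow>
    (\<exists>s\<in>S. \<forall>t\<in>S - {s}. x \<bullet> v t + c t < x \<bullet> v s + c s)"
    (is "?g differentiable _ \<longleftrightarrow> ?U")
proof -
  have aff: "((\<lambda>x. x \<bullet> v s + c s) has_derivative (\<lambda>h. h \<bullet> v s)) (at x)" for s
    by (auto intro!: derivative_eq_intros)
  show ?thesis
  proof
    have ge: "x \<bullet> v s + c s \<le> ?g x" if "s \<in> S" for s x using assms that by simp
    obtain s where s: "s \<in> S" "?g x = x \<bullet> v s + c s"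
      using Max_in[of "(\<lambda>s. x \<bullet> v s + c s) ` S"] assms
      by (metis (no_types, lifting) finite_imageI imageE image_is_empty)
    assume "?g differentiable (at x)"
    then obtain D where D: "(?g has_derivative D) (at x)" unfolding differentiable_def by blast
    have slope: "D = (\<lambda>h. h \<bullet> v t)" if "t \<in> S" "?g x = x \<bullet> v t + c t" for t
    proof -
      \<comment> \<open>The maximum minus an active function is nonnegative and vanishes at
        \<open>x\<close>, so it has a minimum there and its derivative is zero.\<close>
      have "((\<lambda>x. ?g x - (x \<bullet> v t + c t)) has_derivative (\<lambda>h. D h - h \<bullet> v t)) (at x)"
        by (rule has_derivative_diff[OF D aff])
      then have "(\<lambda>h. D h - h \<bullet> v t) = (\<lambda>h. 0)"
        by (rule differential_zero_maxmin[OF UNIV_I open_UNIV])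
          (use ge[OF that(1)] that(2) in auto)
      then show ?thesis by (auto simp: fun_eq_iff)
    qed
    have "x \<bullet> v t + c t < x \<bullet> v s + c s" if "t \<in> S - {s}" for t
    proof (rule ccontr)
      assume "\<not> ?thesis"
      then have "?g x = x \<bullet> v t + c t" using ge[of t x] that s by auto
      then have "(\<lambda>h. h \<bullet> v t) = (\<lambda>h. h \<bullet> v s)" using slope[of t] slope[of s] that s by auto
      then have "v t = v s" by (metis inner_commute vector_eq_rdot)
      then show False using that assms(3) s by (auto dest: inj_onD)
    qed
    then show ?U using s by blast
  next
    assume ?U
    then obtain s where s: "s \<in> S" "\<And>t. t \<in> S - {s} \<Longrightarrow> x \<bullet> v t + c t < x \<bullet> v s + c s" by blast
    have "\<forall>\<^sub>F x' in nhds x. \<forall>t\<in>S - {s}. x' \<bullet> v t + c t < x' \<bullet> v s + c s"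
    proof (rule eventually_ball_finite)
      show "\<forall>t\<in>S - {s}. \<forall>\<^sub>F x' in nhds x. x' \<bullet> v t + c t < x' \<bullet> v s + c s"
      proof
        fix t assume "t \<in> S - {s}"
        then have "x \<in> {x'. x' \<bullet> v t + c t < x' \<bullet> v s + c s}" using s by simp
        moreover have "open {x'. x' \<bullet> v t + c t < x' \<bullet> v s + c s}"
          by (intro open_Collect_less continuous_intros)
        ultimately show "\<forall>\<^sub>F x' in nhds x. x' \<bullet> v t + c t < x' \<bullet> v s + c s"
          by (auto dest: eventually_nhds_in_open)
      qed
    qed (use assms in simp)
    moreover have "x' \<bullet> v s + c s = ?g x'"
      if "\<forall>t\<in>S - {s}. x' \<bullet> v t + c t < x' \<bullet> v s + c s" for x'
    proof (rule Max_eqI[symmetric])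
      fix y assume "y \<in> (\<lambda>s. x' \<bullet> v s + c s) ` S"
      then obtain t where "t \<in> S" "y = x' \<bullet> v t + c t" by blast
      then show "y \<le> x' \<bullet> v s + c s" using that by (cases "t = s") (auto intro: less_imp_le)
    qed (use s(1) assms(1) in auto)
    ultimately have ev: "\<forall>\<^sub>F x' in nhds x. x' \<bullet> v s + c s = ?g x'"
      by (rule eventually_mono)
    from aff have "(?g has_derivative (\<lambda>h. h \<bullet> v s)) (at x)"
    proof (rule has_derivative_transform_eventually)
      show "\<forall>\<^sub>F x' in at x. x' \<bullet> v s + c s = ?g x'"
        using ev by (simp add: eventually_at_filter eventually_mono)
      show "x \<bullet> v s + c s = ?g x" using ev by (rule eventually_nhds_x_imp_x)
    qed simp
    then show "?g differentiable (at x)" unfolding differentiable_def by blast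
  qed
qed

section \<open>Tropical terms and the exponents attaining the maximum\<close>

lemma inj_real_exponent: "inj real_exponent"
  by (auto simp: inj_def real_exponent_def vec_eq_iff)

lemma real_exponent_eq_0_iff: "real_exponent a = 0 \<longleftrightarrow> a = 0"
  by (simp add: real_exponent_def vec_eq_iff)

lemma tropical_term_le:
  "a \<in> Poly_Mapping.keys p \<Longrightarrow> tropical_term p x a \<le> tropical_poly p x"
  by (simp add: tropical_poly_def)

lemma maximal_exponents_nonempty:
  assumes "p \<noteq> 0"
  shows "maximal_exponents p x \<noteq> {}"
proof -
  have "tropical_poly p x \<in> tropical_term p x ` Poly_Mapping.keys p"
    unfolding tropical_poly_def by (rule Max_in) (use assms in simp_all)
  then show ?thesis by (auto simp: maximal_exponents_def)
qed

lemma tropical_term_line: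
  "tropical_term p (x + t *\<^sub>R \<alpha>) a = tropical_term p x a + t * (\<alpha> \<bullet> real_exponent a)"
  by (simp add: tropical_term_def inner_add_left)

lemma tropical_term_convex:
  "tropical_term p ((1 - e) *\<^sub>R x + e *\<^sub>R x') a = (1 - e) * tropical_term p x a + e * tropical_term p x' a"
  by (simp add: tropical_term_def inner_add_left algebra_simps)

lemma maximal_exponents_eqI:
  assumes "\<And>a b. a \<in> I \<Longrightarrow> b \<in> I \<Longrightarrow> tropical_term p x b = tropical_term p x a"
    and "\<And>a b. a \<in> I \<Longrightarrow> b \<in> Poly_Mapping.keys p - I \<Longrightarrow> tropical_term p x b < tropical_term p x a"
    and "I \<noteq> {}" "I \<subseteq> Poly_Mapping.keys p"
  shows "maximal_exponents p x = I"
proof -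
  obtain a where a: "a \<in> I" using assms(3) by blast
  have "tropical_term p x b \<le> tropical_term p x a" if "b \<in> Poly_Mapping.keys p" for b
    using assms(1)[OF a, of b] assms(2)[OF a, of b] that by (cases "b \<in> I") auto
  then have "tropical_poly p x = tropical_term p x a"
    unfolding tropical_poly_def by (intro Max_eqI) (use a assms(4) in auto)
  moreover have "tropical_term p x a = tropical_term p x b \<longleftrightarrow> b \<in> I"
    if "b \<in> Poly_Mapping.keys p" for b
    using assms(1)[OF a, of b] assms(2)[OF a, of b] that by (cases "b \<in> I") auto
  ultimately show ?thesis using assms(4) by (auto simp: maximal_exponents_def)
qed

text \<open>The constant \<open>c\<close> acts as one more term, with exponent 0; it is distinct from all others
  because \<open>p\<close> has no constant term.\<close>

lemma max_tropical_poly_differentiable_iff: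
  fixes p :: "('n::finite, 'k::field puiseux) mpolynomial"
  assumes "p \<noteq> 0" "0 \<notin> Poly_Mapping.keys p"
  shows "(\<lambda>x. max (tropical_poly p x) c) differentiable (at x) \<longleftrightarrow>
    tropical_poly p x < c \<or> (c < tropical_poly p x \<and> (\<exists>a. maximal_exponents p x = {a}))"
proof -
  \<comment> \<open>\<open>None\<close> stands for the constant \<open>c\<close>, with slope 0, and
    \<open>Some a\<close> for the term with exponent \<open>a\<close>.\<close>
  define S where "S = insert None (Some ` Poly_Mapping.keys p)"
  define v where "v = case_option 0 (real_exponent :: nat ^ 'n \<Rightarrow> real ^ 'n)"
  define d where "d = case_option c (\<lambda>a. real_of_ereal (val (Poly_Mapping.lookup p a)))"
  have terms: "x \<bullet> v (Some a) + d (Some a) = tropical_term p x a" "x \<bullet> v None + d None = c" for x a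
    by (simp_all add: v_def d_def tropical_term_def)
  have "max (tropical_poly p x) c = Max ((\<lambda>s. x \<bullet> v s + d s) ` S)" for x
    using assms(1) by (simp add: S_def image_image terms tropical_poly_def max.commute)
  moreover have "finite S" "S \<noteq> {}" by (auto simp: S_def)
  moreover have "inj_on v S"
  proof -
    have "real_exponent a \<noteq> 0" if "a \<in> Poly_Mapping.keys p" for a
      using assms(2) that by (auto simp: real_exponent_eq_0_iff)
    then show ?thesis by (auto simp: inj_on_def S_def v_def inj_eq[OF inj_real_exponent] dest: sym)
  qed
  ultimately have "(\<lambda>x. max (tropical_poly p x) c) differentiable (at x) \<longleftrightarrow>
      (\<exists>s\<in>S. \<forall>t\<in>S - {s}. x \<bullet> v t + d t < x \<bullet> v s + d s)"
    by (simp add: Max_affine_differentiable_iff)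
  also have "\<dots> \<longleftrightarrow> (\<forall>a\<in>Poly_Mapping.keys p. tropical_term p x a < c) \<or>
      (\<exists>a\<in>Poly_Mapping.keys p. c < tropical_term p x a \<and>
        (\<forall>b\<in>Poly_Mapping.keys p - {a}. tropical_term p x b < tropical_term p x a))"
  proof -
    have "S - {None} = Some ` Poly_Mapping.keys p"
      "S - {Some a} = insert None (Some ` (Poly_Mapping.keys p - {a}))" for a
      by (auto simp: S_def)
    then show ?thesis by (simp add: S_def terms)
  qed
  also have "(\<forall>a\<in>Poly_Mapping.keys p. tropical_term p x a < c) \<longleftrightarrow> tropical_poly p x < c"
    using assms(1) by (simp add: tropical_poly_def)
  also have "(\<exists>a\<in>Poly_Mapping.keys p. c < tropical_term p x a \<and>
        (\<forall>b\<in>Poly_Mapping.keys p - {a}. tropical_term p x b < tropical_term p x a)) \<longleftrightarrow>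
      c < tropical_poly p x \<and> (\<exists>a. maximal_exponents p x = {a})" (is "?A \<longleftrightarrow> ?B")
  proof
    assume ?A
    then obtain a where a: "a \<in> Poly_Mapping.keys p" "c < tropical_term p x a"
      "\<And>b. b \<in> Poly_Mapping.keys p - {a} \<Longrightarrow> tropical_term p x b < tropical_term p x a" by blast
    have "maximal_exponents p x = {a}" by (rule maximal_exponents_eqI) (use a in auto)
    then show ?B using a tropical_term_le[OF a(1), of x] by auto
  next
    assume ?B
    then obtain a where a: "maximal_exponents p x = {a}" and c: "c < tropical_poly p x" by blast
    have "tropical_term p x b < tropical_term p x a" if "b \<in> Poly_Mapping.keys p - {a}" for b
    proof -
      have "a \<in> maximal_exponents p x" "b \<notin> maximal_exponents p x" using a that by auto
      then show ?thesis
        using that tropical_term_le[of b p x] by (auto simp: maximal_exponents_def order_less_le)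
    qed
    moreover have "a \<in> Poly_Mapping.keys p" "c < tropical_term p x a"
      using a c by (auto simp: maximal_exponents_def)
    ultimately show ?A by blast
  qed
  finally show ?thesis .
qed

text \<open>Negating the differentiability criterion: either several terms of \<open>f i\<close> tie
  for the maximum at a level at least \<open>y $ i\<close>, or a single term meets the level
  \<open>y $ i\<close>.\<close>

lemma mem_virtual_preimage_iff:
  fixes f :: "'n::finite \<Rightarrow> ('n, 'k::field puiseux) mpolynomial"
  assumes "\<And>i. f i \<noteq> 0" "\<And>i. 0 \<notin> Poly_Mapping.keys (f i)"
  shows "x \<in> virtual_preimage (tropical_map f) y \<longleftrightarrow>
    (\<forall>i. y $ i \<le> tropical_poly (f i) x \<and>
      (is_singleton (maximal_exponents (f i) x) \<longrightarrow> tropical_poly (f i) x = y $ i))"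
proof -
  have "\<not> (P < c \<or> (c < P \<and> s)) \<longleftrightarrow> c \<le> P \<and> (s \<longrightarrow> P = c)" for P c :: real and s by auto
  then show ?thesis
    by (simp only: virtual_preimage_def tropical_map_def vec_lambda_beta mem_Collect_eq
        max_tropical_poly_differentiable_iff[OF assms] is_singleton_def)
qed

lemma virtual_preimage_zero:
  assumes "f i = 0"
  shows "virtual_preimage (tropical_map f) y = {}"
proof -
  \<comment> \<open>The polynomial has no terms, so \<open>tropical_poly\<close> is the unspecified
    constant \<open>Max {}\<close>, and a constant function is differentiable.\<close>
  have "(\<lambda>x. max (tropical_map f x $ i) (y $ i)) differentiable (at x)" for x
    by (simp add: tropical_map_def tropical_poly_def assms)
  then show ?thesis by (auto simp: virtual_preimage_def)
qed

section \<open>Cells\<close>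

lemma cell_decompositionE:
  assumes "\<xi> \<in> cell_decomposition f"
  obtains x0 where "\<xi> = {x. \<forall>i. maximal_exponents (f i) x = maximal_exponents (f i) x0}"
proof -
  obtain x0 where "\<xi> = {(x, x'). \<forall>i. maximal_exponents (f i) x = maximal_exponents (f i) x'} `` {x0}"
    using assms unfolding cell_decomposition_def by (rule quotientE)
  also have "\<dots> = {x. \<forall>i. maximal_exponents (f i) x = maximal_exponents (f i) x0}"
    by (simp add: Image_singleton eq_commute)
  finally show ?thesis by (rule that)
qed

text \<open>The strict inequalities defining the cell can be weakened without changing the closure,
  and the projection of the resulting polyhedron is closed.\<close>

lemma polyhedron_closure_cell_values:
  fixes f :: "'n::finite \<Rightarrow> ('n, 'k::field puiseux) mpolynomial"
  assumes nz: "\<And>i. f i \<noteq> 0" and "\<And>i. 0 \<notin> Poly_Mapping.keys (f i)"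
    and "\<xi> \<in> cell_decomposition f"
  shows "polyhedron (closure (cell_values (tropical_map f) \<xi>))"
proof (cases "cell_values (tropical_map f) \<xi> = {}")
  case False
  note mem = mem_virtual_preimage_iff[of f, OF assms(1,2)]
  obtain x0 where \<xi>: "\<xi> = {x. \<forall>i. maximal_exponents (f i) x = maximal_exponents (f i) x0}"
    using assms(3) by (rule cell_decompositionE)
  define I where "I i = maximal_exponents (f i) x0" for i
  have I: "I i \<noteq> {}" "I i \<subseteq> Poly_Mapping.keys (f i)" for i
    using maximal_exponents_nonempty[OF nz] by (auto simp: I_def maximal_exponents_def)
  have finI: "finite (I i)" for i using I(2) by (rule finite_subset) simp
  \<comment> \<open>The conditions common to \<open>P\<close> and \<open>W\<close>. Equalities are
    written as inequalities in both directions, and quantifying over all of \<open>I i\<close>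
    avoids choosing one maximal exponent.\<close>
  define eqs where "eqs x y \<longleftrightarrow> (\<forall>i. \<forall>a\<in>I i. y $ i \<le> tropical_term (f i) x a \<and>
      (\<forall>b\<in>I i. tropical_term (f i) x b \<le> tropical_term (f i) x a) \<and>
      (is_singleton (I i) \<longrightarrow> tropical_term (f i) x a \<le> y $ i))" for x y
  define P where "P = {(x, y). eqs x y \<and>
    (\<forall>i. \<forall>a\<in>I i. \<forall>b\<in>Poly_Mapping.keys (f i) - I i. tropical_term (f i) x b \<le> tropical_term (f i) x a)}"
  define W where "W = {(x, y). eqs x y \<and>
    (\<forall>i. \<forall>a\<in>I i. \<forall>b\<in>Poly_Mapping.keys (f i) - I i. tropical_term (f i) x b < tropical_term (f i) x a)}"
  have W_eq: "(x, y) \<in> W \<longleftrightarrow> x \<in> \<xi> \<and> x \<in> virtual_preimage (tropical_map f) y" for x y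
  proof
    assume W: "(x, y) \<in> W"
    have "maximal_exponents (f i) x = I i" for i
      by (rule maximal_exponents_eqI)
        (use W I in \<open>auto simp: W_def eqs_def intro: antisym\<close>)
    moreover from this have "tropical_poly (f i) x = tropical_term (f i) x a" if "a \<in> I i" for i a
      using that unfolding maximal_exponents_def by auto
    ultimately show "x \<in> \<xi> \<and> x \<in> virtual_preimage (tropical_map f) y"
      using W I(1) unfolding mem \<xi> I_def[symmetric]
      by (simp add: W_def eqs_def) (metis antisym all_not_in_conv)
  next
    assume *: "x \<in> \<xi> \<and> x \<in> virtual_preimage (tropical_map f) y"
    then have max: "maximal_exponents (f i) x = I i" for i by (simp add: \<xi> I_def)
    then have val: "tropical_poly (f i) x = tropical_term (f i) x a" if "a \<in> I i" for i a
      using that unfolding maximal_exponents_def by auto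
    have "tropical_term (f i) x b < tropical_term (f i) x a"
      if "a \<in> I i" "b \<in> Poly_Mapping.keys (f i) - I i" for i a b
    proof -
      have "b \<notin> maximal_exponents (f i) x" using that max[of i] by simp
      then show ?thesis using that tropical_term_le[of b "f i" x] val[OF that(1)]
        by (auto simp: maximal_exponents_def order_less_le)
    qed
    moreover have "eqs x y"
      using * val unfolding mem eqs_def max by (metis order_refl)
    ultimately show "(x, y) \<in> W" by (simp add: W_def)
  qed
  have V: "cell_values (tropical_map f) \<xi> = snd ` W"
    using W_eq by (force simp: cell_values_def)
  have "W \<subseteq> P" by (auto simp: W_def P_def less_imp_le)
  have lin: "linear (\<lambda>z :: (real ^ 'n) \<times> (real ^ 'n). fst z \<bullet> w)"
    "linear (\<lambda>z :: (real ^ 'n) \<times> (real ^ 'n). snd z $ i)" for w and i :: 'n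
    by (auto simp: linear_iff inner_add_left)
  have le: "polyhedron {z :: (real ^ 'n) \<times> (real ^ 'n). tropical_term (f i) (fst z) b \<le> tropical_term (f i) (fst z) a}"
    "polyhedron {z. tropical_term (f i) (fst z) a \<le> snd z $ i}"
    "polyhedron {z. snd z $ i \<le> tropical_term (f i) (fst z) a}" for i a b
    unfolding tropical_term_def
    using polyhedron_linear_le[OF lin(1) lin(1)] polyhedron_linear_le[OF lin(1) lin(2), where d = 0]
      polyhedron_linear_le[OF lin(2) lin(1), where c = 0] by auto
  have "polyhedron P"
  proof -
    define B where "B z i a \<longleftrightarrow> snd z $ i \<le> tropical_term (f i) (fst z) a \<and>
      (is_singleton (I i) \<longrightarrow> tropical_term (f i) (fst z) a \<le> snd z $ i)" for z i a
    have "polyhedron {z. B z i a}" for i a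
      unfolding B_def Collect_conj_eq by (cases "is_singleton (I i)") (auto simp: le)
    \<comment> \<open>Letting \<open>b\<close> range over all exponents merges the ties within
      \<open>I i\<close> with the weak inequalities against the remaining exponents.\<close>
    then have "polyhedron ({z. \<forall>i\<in>UNIV. \<forall>a\<in>I i. B z i a} \<inter> {z. \<forall>i\<in>UNIV. \<forall>a\<in>I i.
        \<forall>b\<in>Poly_Mapping.keys (f i). tropical_term (f i) (fst z) b \<le> tropical_term (f i) (fst z) a})"
      by (intro polyhedron_Int polyhedron_Collect_ball finI le) auto
    also have "\<dots> = P" using I(2) unfolding P_def eqs_def B_def by (fastforce simp: subset_iff)
    finally show ?thesis .
  qed
  have "P \<subseteq> closure W"
  proof
    fix z assume "z \<in> P"
    from False obtain w where "w \<in> W" unfolding V by blast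
    obtain x y x' y' where z: "z = (x, y)" and w: "w = (x', y')" by fastforce
    \<comment> \<open>The point of \<open>W\<close> has positive weight \<open>e\<close>, so its
      strict inequalities survive the averaging with the weak ones at the point of
      \<open>P\<close>.\<close>
    have "((1 - e) *\<^sub>R x + e *\<^sub>R x', (1 - e) *\<^sub>R y + e *\<^sub>R y') \<in> W" if e: "0 < e" "e \<le> 1" for e
    proof -
      have le: "(1 - e) * p + e * p' \<le> (1 - e) * q + e * q'" if "p \<le> q" "p' \<le> q'" for p p' q q' :: real
        using that e by (intro add_mono mult_left_mono) auto
      have less: "(1 - e) * p + e * p' < (1 - e) * q + e * q'" if "p \<le> q" "p' < q'" for p p' q q' :: real
        using that e by (intro add_le_less_mono mult_left_mono mult_strict_left_mono) auto
      show ?thesis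
        using \<open>z \<in> P\<close> \<open>w \<in> W\<close> unfolding z w P_def W_def eqs_def
        by (auto simp: tropical_term_convex intro!: le less)
    qed
    then show "z \<in> closure W"
      by (intro closure_if_segments[of z w]) (simp add: z w)
  qed
  have "closure (snd ` W) = snd ` P"
  proof
    show "closure (snd ` W) \<subseteq> snd ` P"
      using \<open>W \<subseteq> P\<close> polyhedron_imp_closed[OF polyhedron_snd_image[OF \<open>polyhedron P\<close>]]
      by (intro closure_minimal image_mono)
    have "snd ` closure W \<subseteq> closure (snd ` W)"
      by (rule image_closure_subset) (auto intro: continuous_intros closure_subset[THEN subsetD])
    then show "snd ` P \<subseteq> closure (snd ` W)" using \<open>P \<subseteq> closure W\<close> by blast
  qed
  then show ?thesis using polyhedron_snd_image[OF \<open>polyhedron P\<close>] by (simp add: V)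
qed simp

section \<open>Half-lines in virtual preimages\<close>

lemma nonneg_slope_if_bounded_below:
  fixes c m :: real
  assumes "infinite N" "\<And>n::nat. n \<in> N \<Longrightarrow> l \<le> c + real n * m"
  shows "0 \<le> m"
proof (rule ccontr)
  assume "\<not> 0 \<le> m"
  then obtain k :: nat where k: "(c - l) / (- m) < real k" using reals_Archimedean2 by blast
  obtain n where n: "n \<in> N" "k < n" using assms(1) by (meson infinite_nat_iff_unbounded)
  have "(c - l) / (- m) < real n" using k n(2) by linarith
  then have "c + real n * m < l" using \<open>\<not> 0 \<le> m\<close> by (simp add: field_simps)
  then show False using assms(2)[OF n(1)] by linarith
qed

text \<open>A half-line in a virtual preimage meets some cell infinitely often, so its direction is a
  recession direction of that cell.  Along this direction no component of the tropical map
  decreases on the cell, and the components that are affine near the cell are constant; hence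
  translates of the half-line starting in the cell stay in every virtual preimage they start in.\<close>

lemma nonproper_point_in_cell_values:
  fixes f :: "'n::finite \<Rightarrow> ('n, 'k::field puiseux) mpolynomial"
  assumes nz: "\<And>i. f i \<noteq> 0" and "\<And>i. 0 \<notin> Poly_Mapping.keys (f i)"
    and "y \<in> tropical_nonproper_set (tropical_map f)"
  obtains \<xi> where "\<xi> \<in> cell_decomposition f" "y \<in> cell_values (tropical_map f) \<xi>"
    "cell_values (tropical_map f) \<xi> \<subseteq> tropical_nonproper_set (tropical_map f)"
proof -
  note mem = mem_virtual_preimage_iff[of f, OF assms(1,2)]
  obtain p \<alpha> where \<alpha>: "dicritical \<alpha>"
    and ray: "(\<lambda>t. p + t *\<^sub>R \<alpha>) ` {0..} \<subseteq> virtual_preimage (tropical_map f) y"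
    using assms(3) unfolding tropical_nonproper_set_def by blast
  \<comment> \<open>Integer parameters suffice: infinitely many of these points share their tuple of
    maximal exponents, since only finitely many tuples occur.\<close>
  define r where "r n = p + real n *\<^sub>R \<alpha>" for n
  have r: "r n \<in> virtual_preimage (tropical_map f) y" for n
    using ray unfolding r_def by force
  define M where "M x = (\<lambda>i. maximal_exponents (f i) x)" for x
  have "range (\<lambda>n. M (r n)) \<subseteq> Pi\<^sub>E UNIV (\<lambda>i. Pow (Poly_Mapping.keys (f i)))"
    by (auto simp: M_def maximal_exponents_def)
  then have "finite (range (\<lambda>n. M (r n)))"
    by (rule finite_subset) (intro finite_PiE finite_UNIV; simp)
  from pigeonhole_infinite[OF infinite_UNIV_nat this]
  obtain n0 where "infinite {n. M (r n) = M (r n0)}" by auto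
  define N where "N = {n. M (r n) = M (r n0)}"
  have N: "infinite N" "n0 \<in> N" using \<open>infinite {n. M (r n) = M (r n0)}\<close> by (auto simp: N_def)
  define I where "I i = maximal_exponents (f i) (r n0)" for i
  have I: "I i \<noteq> {}" "I i \<subseteq> Poly_Mapping.keys (f i)" for i
    using maximal_exponents_nonempty[OF nz] by (auto simp: I_def maximal_exponents_def)
  have MN: "maximal_exponents (f i) (r n) = I i" if "n \<in> N" for n i
    using that unfolding N_def M_def I_def by (simp add: fun_eq_iff)
  have val: "tropical_poly (f i) (r n) = tropical_term (f i) p a + real n * (\<alpha> \<bullet> real_exponent a)"
    if "n \<in> N" "a \<in> I i" for n i a
    using MN[OF that(1), of i] that(2) by (auto simp: maximal_exponents_def r_def tropical_term_line)
  \<comment> \<open>The term of \<open>a\<close> is at least that of \<open>b\<close> at infinitely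
    many points of the half-line, so it cannot grow more slowly.\<close>
  have rec: "\<alpha> \<bullet> real_exponent b \<le> \<alpha> \<bullet> real_exponent a"
    if "a \<in> I i" "b \<in> Poly_Mapping.keys (f i)" for i a b
  proof -
    have "tropical_term (f i) p b - tropical_term (f i) p a
        \<le> 0 + real n * (\<alpha> \<bullet> real_exponent a - \<alpha> \<bullet> real_exponent b)" if n: "n \<in> N" for n
      using tropical_term_le[OF \<open>b \<in> _\<close>, of "r n"] val[OF n \<open>a \<in> I i\<close>]
      by (simp add: r_def tropical_term_line algebra_simps)
    from nonneg_slope_if_bounded_below[OF N(1) this] show ?thesis by simp
  qed
  \<comment> \<open>On the half-line the component stays at least \<open>y $ i\<close>, so its slope
    along \<open>N\<close> cannot be negative.\<close>
  have nonneg: "0 \<le> \<alpha> \<bullet> real_exponent a" if "a \<in> I i" for i a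
  proof (rule nonneg_slope_if_bounded_below[OF N(1)])
    show "y $ i \<le> tropical_term (f i) p a + real n * (\<alpha> \<bullet> real_exponent a)" if "n \<in> N" for n
      using r[of n] val[OF that \<open>a \<in> I i\<close>] unfolding mem by metis
  qed
  \<comment> \<open>With a single maximal exponent the component equals \<open>y $ i\<close> at both
    \<open>n0\<close> and a later \<open>n\<close>, so an affine function takes one value
    twice.\<close>
  have zero: "\<alpha> \<bullet> real_exponent a = 0" if "a \<in> I i" "is_singleton (I i)" for i a
  proof -
    obtain n where n: "n \<in> N" "n0 < n" using N(1) by (meson infinite_nat_iff_unbounded)
    have "tropical_poly (f i) (r m) = y $ i" if "m \<in> N" for m
      using r[of m] MN[OF that] \<open>is_singleton (I i)\<close> unfolding mem by simp
    then have "real n * (\<alpha> \<bullet> real_exponent a) = real n0 * (\<alpha> \<bullet> real_exponent a)"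
      using val[OF n(1) that(1)] val[OF N(2) that(1)] n N(2) by simp
    then show ?thesis using n(2) by simp
  qed
  define \<xi> where "\<xi> = {x. \<forall>i. maximal_exponents (f i) x = I i}"
  have "\<xi> = {(x, x'). \<forall>i. maximal_exponents (f i) x = maximal_exponents (f i) x'} `` {r n0}"
    by (simp add: Image_singleton eq_commute \<xi>_def I_def)
  then have "\<xi> \<in> cell_decomposition f"
    unfolding cell_decomposition_def by (simp only: quotientI UNIV_I)
  moreover have "y \<in> cell_values (tropical_map f) \<xi>"
    using r[of n0] by (auto simp: cell_values_def \<xi>_def I_def)
  moreover have "cell_values (tropical_map f) \<xi> \<subseteq> tropical_nonproper_set (tropical_map f)"
  proof
    fix y' assume "y' \<in> cell_values (tropical_map f) \<xi>"
    then obtain x where x: "x \<in> virtual_preimage (tropical_map f) y'" "x \<in> \<xi>"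
      by (auto simp: cell_values_def)
    have xI: "maximal_exponents (f i) x = I i" for i using x(2) by (simp add: \<xi>_def)
    have "x + t *\<^sub>R \<alpha> \<in> virtual_preimage (tropical_map f) y'" if t: "t \<ge> 0" for t
    proof -
      have Mt: "maximal_exponents (f i) (x + t *\<^sub>R \<alpha>) = I i" for i
      proof (rule maximal_exponents_eqI)
        fix a b assume a: "a \<in> I i" and b: "b \<in> I i"
        \<comment> \<open>Both exponents are maximal on the cell, so \<open>rec\<close> applies in
          either order and ties persist along the half-line.\<close>
        then have "\<alpha> \<bullet> real_exponent a = \<alpha> \<bullet> real_exponent b" 
            using rec[OF a, of b] rec[OF b, of a] I(2)[of i] by (intro antisym) auto
        then show "tropical_term (f i) (x + t *\<^sub>R \<alpha>) b = tropical_term (f i) (x + t *\<^sub>R \<alpha>) a"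
          using a b unfolding tropical_term_line xI[symmetric] maximal_exponents_def by simp
      next
        fix a b assume a: "a \<in> I i" and b: "b \<in> Poly_Mapping.keys (f i) - I i"
        have "tropical_term (f i) x b < tropical_term (f i) x a"
          using a b tropical_term_le[of b "f i" x] unfolding xI[symmetric]
          by (auto simp: maximal_exponents_def order_less_le)
        moreover have "t * (\<alpha> \<bullet> real_exponent b) \<le> t * (\<alpha> \<bullet> real_exponent a)"
          using rec[OF a, of b] b t by (intro mult_left_mono) auto
        ultimately show "tropical_term (f i) (x + t *\<^sub>R \<alpha>) b < tropical_term (f i) (x + t *\<^sub>R \<alpha>) a"
          by (simp add: tropical_term_line)
      qed (use I in auto)
      have "y' $ i \<le> tropical_poly (f i) (x + t *\<^sub>R \<alpha>) \<and>
          (is_singleton (I i) \<longrightarrow> tropical_poly (f i) (x + t *\<^sub>R \<alpha>) = y' $ i)" for i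
      proof -
        obtain a where a: "a \<in> I i" using I(1) by blast
        have "a \<in> maximal_exponents (f i) (x + t *\<^sub>R \<alpha>)" "a \<in> maximal_exponents (f i) x"
          using a by (simp_all only: Mt xI)
        then have "tropical_poly (f i) (x + t *\<^sub>R \<alpha>) = tropical_poly (f i) x + t * (\<alpha> \<bullet> real_exponent a)"
          by (simp add: maximal_exponents_def tropical_term_line)
        moreover have "0 \<le> t * (\<alpha> \<bullet> real_exponent a)" using nonneg[OF a] t by simp
        moreover have "y' $ i \<le> tropical_poly (f i) x \<and>
            (is_singleton (I i) \<longrightarrow> tropical_poly (f i) x = y' $ i)"
          using x(1) unfolding mem xI by blast
        ultimately show ?thesis using zero[OF a] by auto
      qed
      then show ?thesis unfolding mem Mt by blast
    qed
    then show "y' \<in> tropical_nonproper_set (tropical_map f)"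
      using \<alpha> unfolding tropical_nonproper_set_def by blast
  qed
  ultimately show ?thesis by (rule that)
qed

theorem theorem1p7:
  fixes A :: "'n::finite \<Rightarrow> (nat ^ 'n) set"
    and f :: "'n \<Rightarrow> ('n, 'k::{alg_closed_field, field_char_0} puiseux) mpolynomial"
    and F :: "real ^ 'n \<Rightarrow> real ^ 'n"
  assumes "\<And>i. finite (A i)"
    and "\<And>i. 0 \<notin> A i"
    and "affine hull (\<Sum>i\<in>UNIV. real_exponent ` A i) = UNIV"
    and "\<And>i. Poly_Mapping.keys (f i) \<subseteq> A i"
    and "face_generic A f"
    and "F = tropical_map f"
  shows "\<exists>\<Upsilon> \<subseteq> cell_decomposition f.
    tropical_nonproper_set F = (\<Union>\<xi>\<in>\<Upsilon>. cell_values F \<xi>) \<and>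
    (\<forall>\<xi>\<in>\<Upsilon>. polyhedron (closure (cell_values F \<xi>)))"
proof (cases "\<exists>i. f i = 0")
  case True
  then obtain i where i: "f i = 0" by blast
  have "tropical_nonproper_set F = {}"
    using virtual_preimage_zero[of f i, OF i] assms(6) by (auto simp: tropical_nonproper_set_def)
  then show ?thesis by (intro exI[of _ "{}"]) simp
next
  case False
  then have nz: "\<And>i. f i \<noteq> 0" by blast
  have n0: "\<And>i. 0 \<notin> Poly_Mapping.keys (f i)" using assms(2,4) by blast
  \<comment> \<open>The largest possible choice: one inclusion then holds by definition, and the
    other asks only for one such cell through each non-proper \<open>y\<close>.\<close>
  define \<Upsilon> where "\<Upsilon> = {\<xi> \<in> cell_decomposition f. cell_values F \<xi> \<subseteq> tropical_nonproper_set F}"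
  have "\<exists>\<xi>\<in>\<Upsilon>. y \<in> cell_values F \<xi>" if "y \<in> tropical_nonproper_set F" for y
    using nonproper_point_in_cell_values[of f y, OF nz n0] that unfolding assms(6) \<Upsilon>_def by blast
  then have "tropical_nonproper_set F = (\<Union>\<xi>\<in>\<Upsilon>. cell_values F \<xi>)"
    unfolding \<Upsilon>_def by blast
  moreover have "\<forall>\<xi>\<in>\<Upsilon>. polyhedron (closure (cell_values F \<xi>))"
    using polyhedron_closure_cell_values[of f, OF nz n0] unfolding assms(6) \<Upsilon>_def by blast
  moreover have "\<Upsilon> \<subseteq> cell_decomposition f" by (auto simp: \<Upsilon>_def)
  ultimately show ?thesis by blast
qed

end
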